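(* Let $a,b,c\in\mathbb{C}$ be the vertices of a nondegenerate triangle (i.e. $a,b,c$ are not collinear) which is not equilateral, and let $f(z)=(z-a)(z-b)(z-c)$. Then the Gaussian curvature $K$ of the graph of $f$, regarded as a function of $z\in\mathbb{C}\cong\mathbb{R}^2$, has exactly five critical points: one of them is a maximum, two are (local) minima, and two are saddle points. Furthermore, the five critical points are determined by the two complex numbers $\mathtt{b}_\triangle=\frac{a+b+c}{3}$ and $\mathtt{B}_\triangle=\mathtt{b}_\triangle^2-\frac{ab+ac+bc}{3}$.
   Context: The graph $\Gamma(f)=\{(z,f(z)):z\in\mathbb{C}\}\subset\mathbb{C}^2\cong\mathbb{R}^4$ is a real surface parametrized by $(x,y)\mapsto(x,y,u(x,y),v(x,y))$, where $z=x+iy$, $f=u+iv$, with the Riemannian metric induced from $\mathbb{R}^4$. Its Gaussian curvature at $(z,f(z))$ is $K(z)=-\frac{\Delta E}{2E^3}$ with $E=1+u_x^2+v_x^2$; explicitly $$K(z)=-\frac{8}{81}\,\frac{|z-\mathtt{b}_\triangle|^2}{\left[\frac19+\left|(z-\mathtt{b}_\triangle)^2-\mathtt{B}_\triangle\right|^2\right]^3}.$$ Critical points of $K$ are points where both partial derivatives $K_x,K_y$ vanish. The triangle is equilateral if and only if $\mathtt{B}_\triangle=0$. *)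

theory Defs
  imports "HOL-Analysis.Analysis"
begin

definition equilateral :: "complex \<Rightarrow> complex \<Rightarrow> complex \<Rightarrow> bool" where
  "equilateral a b c \<longleftrightarrow> dist a b = dist b c \<and> dist b c = dist c a"

definition tri_b :: "complex \<Rightarrow> complex \<Rightarrow> complex \<Rightarrow> complex" where
  "tri_b a b c = (a + b + c) / 3"

definition tri_B :: "complex \<Rightarrow> complex \<Rightarrow> complex \<Rightarrow> complex" where
  "tri_B a b c = (tri_b a b c)\<^sup>2 - (a * b + a * c + b * c) / 3"

definition tri_cubic :: "complex \<Rightarrow> complex \<Rightarrow> complex \<Rightarrow> complex \<Rightarrow> complex" where
  "tri_cubic a b c z = (z - a) * (z - b) * (z - c)"

text \<open>Partial derivatives with respect to the real coordinates of z = x + iy.\<close>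

definition pdx :: "(complex \<Rightarrow> 'v::real_normed_vector) \<Rightarrow> complex \<Rightarrow> 'v" where
  "pdx g z = vector_derivative (\<lambda>t. g (z + of_real t)) (at 0)"

definition pdy :: "(complex \<Rightarrow> 'v::real_normed_vector) \<Rightarrow> complex \<Rightarrow> 'v" where
  "pdy g z = vector_derivative (\<lambda>t. g (z + \<i> * of_real t)) (at 0)"

text \<open>Coefficients of the Riemannian metric induced on a parametrized surface
  by the inner product of the ambient space.\<close>

definition metric_E :: "(complex \<Rightarrow> 'v::real_inner) \<Rightarrow> complex \<Rightarrow> real" where
  "metric_E X z = pdx X z \<bullet> pdx X z"

definition metric_F :: "(complex \<Rightarrow> 'v::real_inner) \<Rightarrow> complex \<Rightarrow> real" where
  "metric_F X z = pdx X z \<bullet> pdy X z"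

definition metric_G :: "(complex \<Rightarrow> 'v::real_inner) \<Rightarrow> complex \<Rightarrow> real" where
  "metric_G X z = pdy X z \<bullet> pdy X z"

text \<open>Gaussian curvature of the metric E dx^2 + 2 F dx dy + G dy^2, by Brioschi's formula;
  it needs no unit normal, so it applies to surfaces of any codimension. For
  E = G and F = 0 it is - \<Delta>(ln E) / (2 E), which for the graph of a holomorphic
  function equals - \<Delta>E / (2 E^3).\<close>

definition brioschi ::
  "(complex \<Rightarrow> real) \<Rightarrow> (complex \<Rightarrow> real) \<Rightarrow> (complex \<Rightarrow> real) \<Rightarrow> complex \<Rightarrow> real" where
  "brioschi E F G z =
    (det (vector
        [vector [- pdy (pdy E) z / 2 + pdy (pdx F) z - pdx (pdx G) z / 2,
                 pdx E z / 2,
                 pdx F z - pdy E z / 2],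
         vector [pdy F z - pdx G z / 2, E z, F z],
         vector [pdy G z / 2, F z, G z]] :: real^3^3)
     - det (vector
        [vector [0, pdy E z / 2, pdx G z / 2],
         vector [pdy E z / 2, E z, F z],
         vector [pdx G z / 2, F z, G z]] :: real^3^3))
    / (E z * G z - (F z)\<^sup>2)\<^sup>2"

definition gaussian_curvature :: "(complex \<Rightarrow> 'v::real_inner) \<Rightarrow> complex \<Rightarrow> real" where
  "gaussian_curvature X = brioschi (metric_E X) (metric_F X) (metric_G X)"

text \<open>The inner product of the type complex \<times> complex is the Euclidean one of
  four-dimensional real space.\<close>

definition graph_param :: "(complex \<Rightarrow> complex) \<Rightarrow> complex \<Rightarrow> complex \<times> complex" where
  "graph_param f z = (z, f z)"

definition graph_curvature :: "(complex \<Rightarrow> complex) \<Rightarrow> complex \<Rightarrow> real" where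
  "graph_curvature f = gaussian_curvature (graph_param f)"

text \<open>Both partial derivatives are required to exist, since \<^const>\<open>vector_derivative\<close>
  has an unspecified value where there is no derivative.\<close>

definition critical_point :: "(complex \<Rightarrow> real) \<Rightarrow> complex \<Rightarrow> bool" where
  "critical_point g z \<longleftrightarrow>
     ((\<lambda>t. g (z + of_real t)) has_real_derivative 0) (at 0) \<and>
     ((\<lambda>t. g (z + \<i> * of_real t)) has_real_derivative 0) (at 0)"

definition global_max :: "(complex \<Rightarrow> real) \<Rightarrow> complex \<Rightarrow> bool" where
  "global_max g z \<longleftrightarrow> (\<forall>w. g w \<le> g z)"

definition local_max :: "(complex \<Rightarrow> real) \<Rightarrow> complex \<Rightarrow> bool" where
  "local_max g z \<longleftrightarrow> (\<forall>\<^sub>F w in nhds z. g w \<le> g z)"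

definition local_min :: "(complex \<Rightarrow> real) \<Rightarrow> complex \<Rightarrow> bool" where
  "local_min g z \<longleftrightarrow> (\<forall>\<^sub>F w in nhds z. g z \<le> g w)"

definition saddle_point :: "(complex \<Rightarrow> real) \<Rightarrow> complex \<Rightarrow> bool" where
  "saddle_point g z \<longleftrightarrow> critical_point g z \<and> \<not> local_max g z \<and> \<not> local_min g z"

text \<open>The critical points of g are exactly p, m1, m2, s1, s2, pairwise distinct, with
  p a maximum, m1 and m2 local minima, s1 and s2 saddle points.\<close>

definition critical_configuration ::
  "(complex \<Rightarrow> real) \<Rightarrow> complex \<Rightarrow> complex \<Rightarrow> complex \<Rightarrow> complex \<Rightarrow> complex \<Rightarrow> bool" where
  "critical_configuration g p m1 m2 s1 s2 \<longleftrightarrow>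
     distinct [p, m1, m2, s1, s2] \<and>
     {z. critical_point g z} = {p, m1, m2, s1, s2} \<and>
     global_max g p \<and>
     local_min g m1 \<and> local_min g m2 \<and>
     saddle_point g s1 \<and> saddle_point g s2"

end

theory Submission
  imports Defs
begin

text \<open>The graph of a holomorphic \<open>f\<close> carries a conformal metric with factor \<open>1 + |f'|\<^sup>2\<close>, and its
curvature is \<open>- 2 |f''|\<^sup>2 / (1 + |f'|\<^sup>2) ^ 3\<close> (\<open>graph_curvature_holomorphic\<close>). For the cubic with
centroid \<open>m\<close> and \<open>w = z - m\<close> one has \<open>f' = 3 (w\<^sup>2 - B)\<close> and \<open>f'' = 6 w\<close>, so the curvature depends
only on \<open>w\<close> and \<open>B\<close>. This gives at once that the critical points are determined by \<open>m\<close> and \<open>B\<close>;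
and \<open>B\<close> is nonzero because the triangle is not equilateral.

The derivative of the curvature in the direction \<open>e\<close> is a nonzero multiple of the real part of
\<open>e\<close> times a fixed complex number, so being critical is one complex equation. Besides \<open>w = 0\<close> it
forces \<open>w\<^sup>2 = t B\<close> with \<open>t\<close> real, and \<open>t\<close> is then a root of a quadratic that has one root above
\<open>1\<close> and one negative root (\<open>critical_equation_iff\<close>, \<open>critical_ratios\<close>). Each root contributes two
opposite values of \<open>w\<close>, which makes five critical points.

At \<open>w = 0\<close> the curvature vanishes, and it is nonpositive everywhere. The other types need no second
derivatives: \<open>|w\<^sup>2 - B|\<close> is, for a given \<open>|w|\<close>, least when \<open>w\<^sup>2\<close> points towards \<open>B\<close> and largest when
it points away from it, and along the two half-lines the curvature as a function of \<open>|w|\<^sup>2\<close> has a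
strict minimum at the critical value (\<open>radial_profile_less\<close>). For the positive root both effects
agree and give a minimum, even a global one; for the negative root they are opposed and give a
saddle.\<close>

section \<open>The curvature of the graph of a holomorphic function\<close>

lemma has_vector_derivative_along:
  fixes f :: "complex \<Rightarrow> complex"
  assumes "(f has_field_derivative D) (at z)"
  shows "((\<lambda>t. f (z + e * of_real t)) has_vector_derivative D * e) (at 0)"
proof -
  have "((\<lambda>t. z + e * of_real t) has_vector_derivative e) (at 0)"
    by (auto intro!: derivative_eq_intros simp: has_vector_derivative_def scaleR_conv_of_real)
  then show ?thesis
    using field_vector_diff_chain_at[of "\<lambda>t. z + e * of_real t" e 0 f D] assms
    by (simp add: o_def mult.commute)
qed

text \<open>The factor \<open>k\<close> carries the constant \<open>2 e\<close> that a first differentiation of \<open>|f'|\<^sup>2\<close> leaves, so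
that the rule serves for the second derivatives too.\<close>

lemma has_real_derivative_inner_along:
  fixes g h :: "complex \<Rightarrow> complex"
  assumes "(g has_field_derivative g') (at z)" "(h has_field_derivative h') (at z)"
  shows "((\<lambda>t. (k * g (z + e * of_real t)) \<bullet> h (z + e * of_real t)) has_real_derivative
    (k * g' * e) \<bullet> h z + (k * g z) \<bullet> (h' * e)) (at 0)"
proof -
  have 1: "((\<lambda>t. k * g (z + e * of_real t)) has_vector_derivative k * (g' * e)) (at 0)"
    using has_vector_derivative_along[OF assms(1), of e]
    by (rule has_vector_derivative_mult_right)
  have "((\<lambda>t. (k * g (z + e * of_real t)) \<bullet> h (z + e * of_real t)) has_derivative
    (\<lambda>t. (k * g (z + e * of_real 0)) \<bullet> (t *\<^sub>R (h' * e)) + (t *\<^sub>R (k * (g' * e))) \<bullet> h (z + e * of_real 0))) (at 0)"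
    by (rule has_derivative_inner)
      (use 1 has_vector_derivative_along[OF assms(2), of e] in \<open>auto simp: has_vector_derivative_def\<close>)
  then show ?thesis
    unfolding has_field_derivative_def
    by (rule has_derivative_eq_rhs) (auto simp: algebra_simps fun_eq_iff)
qed

lemma pdx_eq: "((\<lambda>t. g (z + 1 * of_real t)) has_vector_derivative d) (at 0) \<Longrightarrow> pdx g z = d"
  unfolding pdx_def by (simp add: vector_derivative_at)

lemma pdy_eq: "((\<lambda>t. g (z + \<i> * of_real t)) has_vector_derivative d) (at 0) \<Longrightarrow> pdy g z = d"
  unfolding pdy_def by (rule vector_derivative_at)

text \<open>The first derivatives of \<open>|f'|\<^sup>2\<close> in the two directions together have square sum
  \<open>4 |f' f''|\<^sup>2\<close>, and in its Laplacian the terms with \<open>f'''\<close> cancel, because the squares of the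
  directions \<open>1\<close> and \<open>\<i>\<close> are opposite. Brioschi's formula for a conformal metric then collapses.\<close>

theorem graph_curvature_holomorphic:
  assumes f: "\<And>z. (f has_field_derivative f1 z) (at z)"
    and f1: "\<And>z. (f1 has_field_derivative f2 z) (at z)"
    and f2: "\<And>z. (f2 has_field_derivative f3 z) (at z)"
  shows "graph_curvature f z = - 2 * (cmod (f2 z))\<^sup>2 / (1 + (cmod (f1 z))\<^sup>2) ^ 3"
proof -
  define X where "X = graph_param f"
  define E where "E = (\<lambda>z. 1 + (cmod (f1 z))\<^sup>2)"
  have X: "((\<lambda>t. X (z + e * of_real t)) has_vector_derivative (e, f1 z * e)) (at 0)" for z e
    unfolding X_def graph_param_def
    using has_vector_derivative_along[of "\<lambda>z. z" 1 z e] has_vector_derivative_along[OF f, of z e]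
    by (intro has_vector_derivative_Pair) simp_all
  have pX: "pdx X z = (1, f1 z)" "pdy X z = (\<i>, f1 z * \<i>)" for z
    using pdx_eq[OF X] pdy_eq[OF X] by simp_all
  have metric: "metric_E X = E" "metric_F X = (\<lambda>_. 0)" "metric_G X = E"
    by (auto simp: fun_eq_iff metric_E_def metric_F_def metric_G_def pX E_def inner_complex_def
        cmod_def power2_eq_square)
  have E_eq: "E z = 1 + (1 * f1 z) \<bullet> f1 z" for z
    by (simp add: E_def power2_norm_eq_inner)
  have dE: "((\<lambda>t. E (z + e * of_real t)) has_vector_derivative (2 * e * f2 z) \<bullet> f1 z) (at 0)" for z e
    unfolding E_eq has_real_derivative_iff_has_vector_derivative[symmetric]
    by (rule DERIV_cong[OF DERIV_add[OF DERIV_const has_real_derivative_inner_along[OF f1 f1]]])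
      (simp add: inner_complex_def algebra_simps)
  have ddE: "((\<lambda>t. (2 * e * f2 (z + e * of_real t)) \<bullet> f1 (z + e * of_real t))
      has_vector_derivative (2 * e * f3 z * e) \<bullet> f1 z + (2 * e * f2 z) \<bullet> (f2 z * e)) (at 0)" for z e
    using has_real_derivative_inner_along[OF f2 f1, of "2 * e" z e]
    by (simp add: has_real_derivative_iff_has_vector_derivative)
  have x: "pdx E = (\<lambda>z. (2 * 1 * f2 z) \<bullet> f1 z)" and y: "pdy E = (\<lambda>z. (2 * \<i> * f2 z) \<bullet> f1 z)"
    using pdx_eq[OF dE] pdy_eq[OF dE] by (simp_all add: fun_eq_iff)
  have xx: "pdx (pdx E) z = (2 * 1 * f3 z * 1) \<bullet> f1 z + (2 * 1 * f2 z) \<bullet> (f2 z * 1)"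
    unfolding x by (rule pdx_eq[OF ddE])
  have yy: "pdy (pdy E) z = (2 * \<i> * f3 z * \<i>) \<bullet> f1 z + (2 * \<i> * f2 z) \<bullet> (f2 z * \<i>)"
    unfolding y by (rule pdy_eq[OF ddE])
  have laplace: "pdx (pdx E) z + pdy (pdy E) z = 4 * (cmod (f2 z))\<^sup>2"
    unfolding xx yy cmod_power2 inner_complex_def by (simp add: algebra_simps power2_eq_square)
  have gradient: "(pdx E z)\<^sup>2 + (pdy E z)\<^sup>2 = 4 * (cmod (f2 z))\<^sup>2 * (E z - 1)"
  proof -
    have "E z - 1 = (cmod (f1 z))\<^sup>2" by (simp add: E_def)
    then show ?thesis
      unfolding x y cmod_power2 inner_complex_def
      by (simp only:) (simp add: algebra_simps power2_eq_square)
  qed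
  have F: "pdx (\<lambda>_. 0 :: real) = (\<lambda>_. 0)" "pdy (\<lambda>_. 0 :: real) = (\<lambda>_. 0)"
    unfolding pdx_def pdy_def by (simp_all add: fun_eq_iff)
  have "E z > 0"
    unfolding E_def by (simp add: add_pos_nonneg)
  have "graph_curvature f z =
      (((pdx E z)\<^sup>2 + (pdy E z)\<^sup>2) - (pdx (pdx E) z + pdy (pdy E) z) * E z) / (2 * E z ^ 3)"
    using \<open>E z > 0\<close>
    unfolding graph_curvature_def gaussian_curvature_def X_def[symmetric] metric brioschi_def F det_3
    by (simp add: vector_3 field_simps power2_eq_square power3_eq_cube)
  also have "\<dots> = - 2 * (cmod (f2 z))\<^sup>2 / E z ^ 3"
    unfolding laplace gradient using \<open>E z > 0\<close> by (simp add: field_simps)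
  finally show ?thesis
    by (simp add: E_def)
qed

section \<open>The curvature of the graph of a cubic\<close>

definition cubic_curvature :: "complex \<Rightarrow> complex \<Rightarrow> real" where
  "cubic_curvature B w = - 72 * (cmod w)\<^sup>2 / (1 + 9 * (cmod (w\<^sup>2 - B))\<^sup>2) ^ 3"

lemma graph_curvature_tri_cubic:
  "graph_curvature (tri_cubic a b c) = (\<lambda>z. cubic_curvature (tri_B a b c) (z - tri_b a b c))"
proof
  fix z
  define m B where "m = tri_b a b c" and "B = tri_B a b c"
  have "a * b + a * c + b * c = 3 * m\<^sup>2 - 3 * B" "a + b + c = 3 * m"
    by (simp_all add: m_def B_def tri_B_def tri_b_def field_simps)
  then have "tri_cubic a b c = (\<lambda>z. z ^ 3 - 3 * m * z\<^sup>2 + (3 * m\<^sup>2 - 3 * B) * z - a * b * c)"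
    unfolding fun_eq_iff tri_cubic_def by algebra
  then have f: "(tri_cubic a b c has_field_derivative 3 * ((z - m)\<^sup>2 - B)) (at z)" for z
    by (auto intro!: derivative_eq_intros simp: power2_eq_square algebra_simps)
  have f1: "((\<lambda>z. 3 * ((z - m)\<^sup>2 - B)) has_field_derivative 6 * (z - m)) (at z)" for z
    by (auto intro!: derivative_eq_intros)
  have f2: "((\<lambda>z. 6 * (z - m)) has_field_derivative 6) (at z)" for z
    by (auto intro!: derivative_eq_intros)
  show "graph_curvature (tri_cubic a b c) z = cubic_curvature B (z - m)"
    unfolding graph_curvature_holomorphic[OF f f1 f2] cubic_curvature_def norm_mult power_mult_distrib
    by simp
qed

text \<open>With \<open>p = a - b\<close> and \<open>q = b - c\<close>, the number \<open>9 B\<close> is \<open>p\<^sup>2 + p q + q\<^sup>2\<close>, a factor of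
\<open>p ^ 3 - q ^ 3\<close>. If it vanishes, the cubes of \<open>p\<close> and \<open>q\<close> agree, and so do their moduli; \<open>B\<close> is
symmetric in the vertices, so the same holds for every pair of sides.\<close>

lemma equilateral_if_tri_B_eq_0:
  assumes "tri_B a b c = 0"
  shows "equilateral a b c"
proof -
  have "(a + b + c)\<^sup>2 = 3 * (a * b + a * c + b * c)"
    using assms by (simp add: tri_B_def tri_b_def power_divide field_simps)
  then have "(a - b) ^ 3 = (b - c) ^ 3" "(b - c) ^ 3 = (c - a) ^ 3"
    by algebra+
  then have "cmod (a - b) ^ 3 = cmod (b - c) ^ 3" "cmod (b - c) ^ 3 = cmod (c - a) ^ 3"
    by (metis norm_power)+
  then show ?thesis
    by (auto simp: equilateral_def dist_norm power_eq_iff_eq_base)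
qed

section \<open>The critical points\<close>

text \<open>The derivative is written as \<open>Re (e * H)\<close> up to a nonzero factor, because this vanishes for
both \<open>e = 1\<close> and \<open>e = \<i>\<close> exactly when the complex number \<open>H\<close> does.\<close>

lemma cubic_curvature_has_real_derivative:
  fixes B m z e :: complex
  defines "w \<equiv> z - m"
  defines "D \<equiv> 1 + 9 * (cmod (w\<^sup>2 - B))\<^sup>2"
  shows "((\<lambda>t. cubic_curvature B (z + e * of_real t - m)) has_real_derivative
    - (144 / D ^ 4) * Re (e * (cnj w * (D - 54 * w\<^sup>2 * cnj (w\<^sup>2 - B))))) (at 0)"
proof -
  define q where "q = w\<^sup>2 - B"
  have D: "D > 0" unfolding D_def by (simp add: add_pos_nonneg)
  have d1: "((\<lambda>z. z - m) has_field_derivative 1) (at z)"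
    and d2: "((\<lambda>z. (z - m)\<^sup>2 - B) has_field_derivative 2 * w) (at z)"
    by (auto intro!: derivative_eq_intros simp: w_def)
  define N where "N = (\<lambda>t. (z + e * of_real t - m) \<bullet> (z + e * of_real t - m))"
  define Q where "Q = (\<lambda>t. ((z + e * of_real t - m)\<^sup>2 - B) \<bullet> ((z + e * of_real t - m)\<^sup>2 - B))"
  have N: "(N has_real_derivative 2 * (e \<bullet> w)) (at 0)"
    using has_real_derivative_inner_along[OF d1 d1, of 1 e]
    unfolding N_def by (simp add: w_def inner_commute)
  have Q: "(Q has_real_derivative 4 * ((w * e) \<bullet> q)) (at 0)"
    unfolding Q_def
    by (rule DERIV_cong[OF has_real_derivative_inner_along[OF d2 d2, of 1 e, unfolded mult_1]])
      (simp add: q_def w_def inner_complex_def algebra_simps)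
  have R: "((\<lambda>t. 1 + 9 * Q t) has_real_derivative 36 * ((w * e) \<bullet> q)) (at 0)"
    by (rule DERIV_cong[OF DERIV_add[OF DERIV_const DERIV_cmult[OF Q]]]) simp
  have NQ0: "N 0 = (cmod w)\<^sup>2" "1 + 9 * Q 0 = D"
    by (simp_all add: N_def Q_def w_def D_def power2_norm_eq_inner)
  have "((\<lambda>t. - 72 * N t / (1 + 9 * Q t) ^ 3) has_real_derivative
      (- 144 * (e \<bullet> w) * D ^ 3 + 72 * (cmod w)\<^sup>2 * (3 * D\<^sup>2 * (36 * ((w * e) \<bullet> q)))) / (D ^ 3)\<^sup>2) (at 0)"
    using D
    by (intro DERIV_cong[OF DERIV_divide[OF DERIV_cmult[OF N] DERIV_power[OF R]]])
      (simp_all add: NQ0 power2_eq_square)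
  moreover have "(- 144 * (e \<bullet> w) * D ^ 3 + 72 * (cmod w)\<^sup>2 * (3 * D\<^sup>2 * (36 * ((w * e) \<bullet> q)))) / (D ^ 3)\<^sup>2
      = - (144 / D ^ 4) * ((e \<bullet> w) * D - 54 * (cmod w)\<^sup>2 * ((w * e) \<bullet> q))"
    using D by (simp add: field_simps power2_eq_square) (simp add: algebra_simps power_numeral_reduce)
  moreover have "(e \<bullet> w) * D - 54 * (cmod w)\<^sup>2 * ((w * e) \<bullet> q)
      = Re (e * (cnj w * (D - 54 * w\<^sup>2 * cnj q)))"
    unfolding cmod_power2 inner_complex_def by (simp add: algebra_simps power2_eq_square)
  moreover have "(\<lambda>t. cubic_curvature B (z + e * of_real t - m)) = (\<lambda>t. - 72 * N t / (1 + 9 * Q t) ^ 3)"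
    by (simp add: cubic_curvature_def N_def Q_def power2_norm_eq_inner)
  ultimately show ?thesis
    by (simp only: q_def)
qed

lemma critical_point_cubic_curvature_iff:
  "critical_point (\<lambda>z. cubic_curvature B (z - m)) z \<longleftrightarrow>
    z = m \<or> 54 * (z - m)\<^sup>2 * cnj ((z - m)\<^sup>2 - B) = 1 + 9 * (cmod ((z - m)\<^sup>2 - B))\<^sup>2"
proof -
  define w where "w = z - m"
  define D where "D = 1 + 9 * (cmod (w\<^sup>2 - B))\<^sup>2"
  define H where "H = cnj w * (D - 54 * w\<^sup>2 * cnj (w\<^sup>2 - B))"
  have "D > 0" unfolding D_def by (simp add: add_pos_nonneg)
  note d = cubic_curvature_has_real_derivative[of B z _ m, folded w_def, folded D_def, folded H_def]
  have "((\<lambda>t. cubic_curvature B (z + e * of_real t - m)) has_real_derivative 0) (at 0)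
      \<longleftrightarrow> Re (e * H) = 0" for e
    using d[of e] DERIV_unique[OF d[of e]] \<open>D > 0\<close> by fastforce
  from this[of 1] this[of \<i>]
  have "critical_point (\<lambda>z. cubic_curvature B (z - m)) z \<longleftrightarrow> H = 0"
    by (auto simp: critical_point_def complex_eq_iff)
  then show ?thesis
    by (auto simp: H_def D_def w_def)
qed

text \<open>The real values that \<open>w\<^sup>2 / B\<close> takes at the critical points with \<open>w \<noteq> 0\<close>.\<close>

definition critical_ratio :: "complex \<Rightarrow> real \<Rightarrow> bool" where
  "critical_ratio B t \<longleftrightarrow> 1 + 9 * (cmod B)\<^sup>2 * (t - 1)\<^sup>2 = 54 * (cmod B)\<^sup>2 * (t * (t - 1))"

text \<open>The right-hand side of the critical equation is real, hence so is \<open>s * cnj (s - B)\<close> for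
  \<open>s = w\<^sup>2\<close>, hence so is \<open>s * cnj B\<close>: thus \<open>s\<close> is a real multiple of \<open>B\<close>.\<close>

lemma critical_equation_iff:
  assumes "B \<noteq> 0"
  shows "54 * s * cnj (s - B) = 1 + 9 * (cmod (s - B))\<^sup>2 \<longleftrightarrow>
    (\<exists>t. critical_ratio B t \<and> s = of_real t * B)"
proof -
  define t where "t = s / B"
  have s: "s = t * B" using assms by (simp add: t_def)
  have "54 * s * cnj (s - B) = of_real (54 * (cmod B)\<^sup>2) * (t * cnj (t - 1))"
    unfolding s of_real_mult complex_norm_square by (simp add: algebra_simps)
  moreover have "s - B = (t - 1) * B" by (simp add: s algebra_simps)
  then have "(cmod (s - B))\<^sup>2 = (cmod B)\<^sup>2 * (cmod (t - 1))\<^sup>2"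
    by (simp add: norm_mult power_mult_distrib)
  ultimately have "54 * s * cnj (s - B) = 1 + 9 * of_real ((cmod (s - B))\<^sup>2) \<longleftrightarrow>
     of_real (54 * (cmod B)\<^sup>2) * (t * cnj (t - 1)) = of_real (1 + 9 * (cmod B)\<^sup>2 * (cmod (t - 1))\<^sup>2)"
    by (simp only: of_real_add of_real_mult of_real_1 of_real_numeral mult.assoc)
  also have "\<dots> \<longleftrightarrow> Im t = 0 \<and> critical_ratio B (Re t)"
  proof -
    have "(cmod (t - 1))\<^sup>2 = (Re t - 1)\<^sup>2 + (Im t)\<^sup>2" by (simp add: cmod_power2)
    then show ?thesis
      using assms by (auto simp: complex_eq_iff critical_ratio_def algebra_simps)
  qed
  also have "\<dots> \<longleftrightarrow> (\<exists>x. critical_ratio B x \<and> t = of_real x)"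
    by (auto simp: complex_eq_iff)
  also have "\<dots> \<longleftrightarrow> (\<exists>x. critical_ratio B x \<and> s = of_real x * B)"
    using assms by (auto simp: s)
  finally show ?thesis by simp
qed

text \<open>Completing the square turns the equation of the critical ratios into
  \<open>(5 t - 2)\<^sup>2 = 9 + 5 / (9 |B|\<^sup>2)\<close>, whose right-hand side exceeds \<open>3\<^sup>2\<close>.\<close>

lemma critical_ratios:
  assumes "B \<noteq> 0"
  obtains t1 t2 where "t1 > 1" "t2 < 0" "\<And>t. critical_ratio B t \<longleftrightarrow> t = t1 \<or> t = t2"
proof -
  define r where "r = sqrt (9 + 5 / (9 * (cmod B)\<^sup>2))"
  have "sqrt (3\<^sup>2) < r" unfolding r_def using assms by (intro real_sqrt_less_mono) simp
  then have r: "r > 3" by simp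
  have r2: "r\<^sup>2 = 9 + 5 / (9 * (cmod B)\<^sup>2)" unfolding r_def using assms by simp
  have "critical_ratio B t \<longleftrightarrow> (5 * t - 2)\<^sup>2 = r\<^sup>2" for t
    unfolding r2 critical_ratio_def using assms
    by (simp add: field_simps power2_eq_square) (auto simp: algebra_simps)
  then have "critical_ratio B t \<longleftrightarrow> t = (2 + r) / 5 \<or> t = (2 - r) / 5" for t
    unfolding power2_eq_iff by (auto simp: field_simps)
  with r show thesis by (intro that[of "(2 + r) / 5" "(2 - r) / 5"]) auto
qed

section \<open>Minima and saddle points\<close>

text \<open>When \<open>w\<^sup>2\<close> is confined to the half-line from \<open>0\<close> through \<open>B\<close> or through \<open>- B\<close>, the curvature
  is \<open>- 72 r / (1 + 9 (r - h)\<^sup>2) ^ 3\<close>, with \<open>r = |w|\<^sup>2\<close> and \<open>h = \<plusminus>|B|\<close>. The denominator before cubing is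
  strictly convex in \<open>r\<close>, hence lies above its tangent at \<open>r0\<close>, which by the critical equation is
  \<open>1 + (r - r0) / (3 r0)\<close> times its value at \<open>r0\<close>; and by Bernoulli's inequality the cube of that
  factor is at least \<open>r / r0\<close>.\<close>

lemma radial_profile_less:
  fixes r r0 h :: real
  assumes "r \<ge> 0" "r0 > 0" "r \<noteq> r0"
    and crit: "1 + 9 * (r0 - h)\<^sup>2 = 54 * r0 * (r0 - h)"
  shows "r / (1 + 9 * (r - h)\<^sup>2) ^ 3 < r0 / (1 + 9 * (r0 - h)\<^sup>2) ^ 3"
proof -
  define D where "D = (\<lambda>r. 1 + 9 * (r - h)\<^sup>2)"
  have D: "D x > 0" for x unfolding D_def by (simp add: add_pos_nonneg)
  define y where "y = (r - r0) / r0"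
  have y: "y \<ge> -1" and ry: "r = r0 * (1 + y)" using assms by (auto simp: y_def field_simps)
  have "D r0 * y = 54 * (r0 - h) * (r - r0)"
    unfolding D_def crit y_def using \<open>r0 > 0\<close> by simp
  then have "D r0 * (1 + y / 3) = D r0 + 18 * (r0 - h) * (r - r0)"
    by (simp add: algebra_simps)
  also have "\<dots> = D r - 9 * (r - r0)\<^sup>2"
    by (simp add: D_def power2_eq_square algebra_simps)
  also have "\<dots> < D r" using assms by simp
  finally have "(D r0 * (1 + y / 3)) ^ 3 < D r ^ 3"
    using y D[of r0] by (intro power_strict_mono) auto
  moreover have "1 + y \<le> (1 + y / 3) ^ 3"
  proof -
    have "(1 + y / 3) ^ 3 = 1 + y + y\<^sup>2 * (9 + y) / 27"
      by (simp add: power2_eq_square power3_eq_cube field_simps)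
    then show ?thesis using y by simp
  qed
  then have "D r0 ^ 3 * (1 + y) \<le> (D r0 * (1 + y / 3)) ^ 3"
    using D[of r0] by (simp add: power_mult_distrib)
  ultimately have "D r0 ^ 3 * (1 + y) < D r ^ 3" by linarith
  then have "r0 * (D r0 ^ 3 * (1 + y)) < r0 * D r ^ 3" using \<open>r0 > 0\<close> by simp
  then have "r / D r ^ 3 < r0 / D r0 ^ 3"
    using D[of r] D[of r0] by (simp add: ry field_simps)
  then show ?thesis by (simp add: D_def)
qed

lemma critical_ratio_radial:
  assumes "critical_ratio B t"
  shows "1 + 9 * (t * cmod B - cmod B)\<^sup>2 = 54 * (t * cmod B) * (t * cmod B - cmod B)"
  using assms by (simp add: critical_ratio_def power2_eq_square algebra_simps)

lemma cubic_curvature_of_real_square: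
  assumes "w\<^sup>2 = of_real t * B"
  shows "cubic_curvature B w
    = - 72 * (\<bar>t\<bar> * cmod B) / (1 + 9 * (t * cmod B - cmod B)\<^sup>2) ^ 3"
proof -
  have "(cmod w)\<^sup>2 = \<bar>t\<bar> * cmod B"
    using arg_cong[OF assms, of cmod] by (simp add: norm_mult norm_power)
  moreover have "w\<^sup>2 - B = of_real (t - 1) * B" using assms by (simp add: algebra_simps)
  then have "(cmod (w\<^sup>2 - B))\<^sup>2 = (t * cmod B - cmod B)\<^sup>2"
    by (simp only: norm_mult norm_of_real power_mult_distrib power2_abs)
       (simp add: power2_eq_square algebra_simps)
  ultimately show ?thesis by (simp add: cubic_curvature_def)
qed

text \<open>Among the points with a given \<open>|w|\<close>, the curvature is least where \<open>w\<^sup>2\<close> is nearest to \<open>B\<close>,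
  that is, on the half-line of \<open>B\<close>; there the radial estimate applies. The minimum is global.\<close>

lemma cubic_curvature_minimum:
  assumes "B \<noteq> 0" "critical_ratio B t" "t > 1" "v\<^sup>2 = of_real t * B"
  shows "cubic_curvature B v \<le> cubic_curvature B w"
proof -
  define r r0 where "r = (cmod w)\<^sup>2" and "r0 = t * cmod B"
  define D where "D = (\<lambda>r. 1 + 9 * (r - cmod B)\<^sup>2)"
  have D: "D x > 0" for x unfolding D_def by (simp add: add_pos_nonneg)
  have "r0 > 0" "r \<ge> 0" using assms by (auto simp: r0_def r_def)
  then have le: "r / D r ^ 3 \<le> r0 / D r0 ^ 3"
    using radial_profile_less[of r r0 "cmod B"] critical_ratio_radial[OF assms(2)]
    unfolding D_def r0_def by (cases "r = t * cmod B") auto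
  have "\<bar>r - cmod B\<bar> \<le> cmod (w\<^sup>2 - B)"
    using norm_triangle_ineq3[of "w\<^sup>2" B] by (simp add: r_def norm_power)
  then have "(r - cmod B)\<^sup>2 \<le> (cmod (w\<^sup>2 - B))\<^sup>2"
    by (metis abs_ge_zero power2_abs power_mono)
  then have "D r \<le> 1 + 9 * (cmod (w\<^sup>2 - B))\<^sup>2" by (simp add: D_def)
  then have "r / (1 + 9 * (cmod (w\<^sup>2 - B))\<^sup>2) ^ 3 \<le> r / D r ^ 3"
    using D[of r] \<open>r \<ge> 0\<close> by (intro divide_left_mono power_mono mult_pos_pos) auto
  with le have "r / (1 + 9 * (cmod (w\<^sup>2 - B))\<^sup>2) ^ 3 \<le> r0 / D r0 ^ 3" by linarith
  then show ?thesis
    unfolding cubic_curvature_of_real_square[OF assms(4)] unfolding cubic_curvature_def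
    using assms(3) by (simp add: r_def r0_def D_def)
qed

text \<open>At a critical ratio \<open>t < 0\<close>, stretching \<open>v\<close> by a real factor moves \<open>v\<^sup>2\<close> along the half-line
  opposite to \<open>B\<close>, where the radial estimate makes the curvature increase.\<close>

lemma cubic_curvature_scaled:
  assumes "B \<noteq> 0" "critical_ratio B t" "t < 0" "v\<^sup>2 = of_real t * B" "x > 0"
  shows "cubic_curvature B v < cubic_curvature B (v * of_real (1 + x))"
proof -
  define u where "u = t * (1 + x)\<^sup>2"
  have sq: "(v * of_real (1 + x))\<^sup>2 = of_real u * B"
    using assms(4) by (simp add: u_def power_mult_distrib)
  have "(1 + x)\<^sup>2 > 1" using assms(5) by (simp add: power2_eq_square algebra_simps add_pos_pos)
  then have u: "u < t" using assms(3) by (simp add: u_def)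
  have flip: "(- s * cmod B - - cmod B)\<^sup>2 = (s * cmod B - cmod B)\<^sup>2" for s
    by (simp add: power2_eq_square algebra_simps)
  have "(- u * cmod B) / (1 + 9 * (- u * cmod B - - cmod B)\<^sup>2) ^ 3
      < (- t * cmod B) / (1 + 9 * (- t * cmod B - - cmod B)\<^sup>2) ^ 3"
    using u assms critical_ratio_radial[OF assms(2)]
    by (intro radial_profile_less)
      (auto simp: mult_neg_pos flip mult_nonpos_nonneg algebra_simps power2_eq_square)
  then show ?thesis
    unfolding cubic_curvature_of_real_square[OF assms(4)] cubic_curvature_of_real_square[OF sq] flip
    using u assms(3) by simp
qed

text \<open>Rotating \<open>v\<close> keeps \<open>|v|\<close> and brings \<open>v\<^sup>2\<close>, which is opposite to \<open>B\<close>, nearer to \<open>B\<close>.\<close>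

lemma cubic_curvature_rotated:
  assumes "B \<noteq> 0" "t < 0" "v\<^sup>2 = of_real t * B" "0 < x" "x < 1"
  shows "cubic_curvature B (v * cis x) < cubic_curvature B v"
proof -
  have "sin x > 0" using assms pi_ge_two by (intro sin_gt_zero) auto
  have cs: "cos (2 * x) < 1" using \<open>sin x > 0\<close> by (simp add: cos_double_sin)
  have "(cis x)\<^sup>2 = cis (2 * x)" using Complex.DeMoivre[of x 2] by simp
  then have "(v * cis x)\<^sup>2 - B = (of_real t * cis (2 * x) - 1) * B"
    using assms(3) by (simp add: power_mult_distrib algebra_simps)
  then have 1: "(cmod ((v * cis x)\<^sup>2 - B))\<^sup>2 = (cmod (of_real t * cis (2 * x) - 1))\<^sup>2 * (cmod B)\<^sup>2"
    by (simp add: norm_mult power_mult_distrib)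
  have "v\<^sup>2 - B = of_real (t - 1) * B" using assms(3) by (simp add: algebra_simps)
  then have 2: "(cmod (v\<^sup>2 - B))\<^sup>2 = (t - 1)\<^sup>2 * (cmod B)\<^sup>2"
    by (simp only: norm_mult norm_of_real power_mult_distrib power2_abs)
  have "(cmod (of_real t * cis (2 * x) - 1))\<^sup>2 = (t * cos (2 * x) - 1)\<^sup>2 + (t * sin (2 * x))\<^sup>2"
    by (simp add: cmod_power2)
  also have "\<dots> = t\<^sup>2 * ((cos (2 * x))\<^sup>2 + (sin (2 * x))\<^sup>2) - 2 * t * cos (2 * x) + 1"
    by algebra
  also have "(cos (2 * x))\<^sup>2 + (sin (2 * x))\<^sup>2 = 1" by simp
  also have "t\<^sup>2 * 1 - 2 * t * cos (2 * x) + 1 = (t - 1)\<^sup>2 + 2 * t * (1 - cos (2 * x))"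
    by (simp add: power2_eq_square algebra_simps)
  also have "\<dots> < (t - 1)\<^sup>2" using assms(2) cs by (simp add: mult_neg_pos)
  finally have "1 + 9 * (cmod ((v * cis x)\<^sup>2 - B))\<^sup>2 < 1 + 9 * (cmod (v\<^sup>2 - B))\<^sup>2"
    unfolding 1 2 using assms(1) by simp
  moreover have "v \<noteq> 0" using assms by auto
  ultimately have "(cmod v)\<^sup>2 / (1 + 9 * (cmod (v\<^sup>2 - B))\<^sup>2) ^ 3
      < (cmod v)\<^sup>2 / (1 + 9 * (cmod ((v * cis x)\<^sup>2 - B))\<^sup>2) ^ 3"
    by (intro divide_strict_left_mono power_strict_mono mult_pos_pos zero_less_power)
       (auto intro: add_pos_nonneg)
  then show ?thesis by (simp add: cubic_curvature_def norm_mult)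
qed

lemma eventually_nhds_along_curve:
  assumes "\<forall>\<^sub>F w in nhds z. P w" "(\<gamma> \<longlongrightarrow> z) (at_right (0::real))"
  obtains x where "0 < x" "x < 1" "P (\<gamma> x)"
proof -
  have "\<forall>\<^sub>F x in at_right 0. P (\<gamma> x)"
    using assms by (auto simp: filterlim_iff)
  moreover have "\<forall>\<^sub>F x in at_right 0. x \<in> {0<..<1::real}"
    by (rule eventually_at_right_real) simp
  ultimately have "\<forall>\<^sub>F x in at_right 0. P (\<gamma> x) \<and> x \<in> {0<..<1}"
    by (rule eventually_conj)
  then obtain x where "P (\<gamma> x) \<and> x \<in> {0<..<1}"
    using eventually_happens'[OF trivial_limit_at_right_real] by blast
  then show thesis by (intro that) auto
qed

lemma cubic_curvature_saddle:
  assumes "B \<noteq> 0" "critical_ratio B t" "t < 0" "v\<^sup>2 = of_real t * B"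
  shows "saddle_point (\<lambda>z. cubic_curvature B (z - m)) (m + v)"
  unfolding saddle_point_def
proof (intro conjI notI)
  show "critical_point (\<lambda>z. cubic_curvature B (z - m)) (m + v)"
    unfolding critical_point_cubic_curvature_iff critical_equation_iff[OF assms(1)]
    using assms by auto
next
  assume "local_max (\<lambda>z. cubic_curvature B (z - m)) (m + v)"
  moreover have "((\<lambda>x. m + v * of_real (1 + x)) \<longlongrightarrow> m + v) (at_right 0)"
    by (rule tendsto_eq_intros refl | simp)+
  ultimately obtain x where "x > 0" "cubic_curvature B (v * of_real (1 + x)) \<le> cubic_curvature B v"
    unfolding local_max_def by (rule eventually_nhds_along_curve) auto
  with cubic_curvature_scaled[OF assms] show False by fastforce
next
  assume "local_min (\<lambda>z. cubic_curvature B (z - m)) (m + v)"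
  moreover have "((\<lambda>x. m + v * cis x) \<longlongrightarrow> m + v * cis 0) (at_right 0)"
    by (intro tendsto_intros)
  then have "((\<lambda>x. m + v * cis x) \<longlongrightarrow> m + v) (at_right 0)" by simp
  ultimately obtain x where "0 < x" "x < 1" "cubic_curvature B v \<le> cubic_curvature B (v * cis x)"
    unfolding local_min_def by (rule eventually_nhds_along_curve) auto
  with cubic_curvature_rotated[OF assms(1,3,4)] show False by fastforce
qed

theorem cubic_curvature_critical_configuration:
  assumes "B \<noteq> 0"
  obtains u v where
    "critical_configuration (\<lambda>z. cubic_curvature B (z - m)) m (m + u) (m - u) (m + v) (m - v)"
proof -
  obtain t1 t2 where t: "t1 > 1" "t2 < 0" "\<And>t. critical_ratio B t \<longleftrightarrow> t = t1 \<or> t = t2"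
    using critical_ratios[OF assms] by metis
  define u v where "u = csqrt (of_real t1 * B)" and "v = csqrt (of_real t2 * B)"
  have u2: "u\<^sup>2 = of_real t1 * B" "(- u)\<^sup>2 = of_real t1 * B"
    and v2: "v\<^sup>2 = of_real t2 * B" "(- v)\<^sup>2 = of_real t2 * B"
    by (simp_all add: u_def v_def)
  have nz: "u \<noteq> 0" "v \<noteq> 0" using t assms by (auto simp: u_def v_def)
  have "u\<^sup>2 \<noteq> v\<^sup>2" using u2 v2 t assms by auto
  then have ne: "u \<noteq> v" "u \<noteq> - v" by auto
  let ?g = "\<lambda>z. cubic_curvature B (z - m)"
  have "distinct [m, m + u, m - u, m + v, m - v]"
    using nz ne by (auto simp: complex_eq_iff)
  moreover have "{z. critical_point ?g z} = {m, m + u, m - u, m + v, m - v}"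
  proof -
    have "critical_point ?g z \<longleftrightarrow> z = m \<or> (z - m)\<^sup>2 = u\<^sup>2 \<or> (z - m)\<^sup>2 = v\<^sup>2" for z
      unfolding critical_point_cubic_curvature_iff critical_equation_iff[OF assms] t(3) u2 v2 by auto
    moreover have "(z - m)\<^sup>2 = x\<^sup>2 \<longleftrightarrow> z = m + x \<or> z = m - x" for z x
      unfolding power2_eq_iff diff_eq_eq by (simp add: add.commute)
    ultimately show ?thesis by auto
  qed
  moreover have "global_max ?g m"
    by (auto simp: global_max_def cubic_curvature_def intro!: divide_nonneg_nonneg)
  moreover have "local_min ?g (m + u)" "local_min ?g (m - u)"
    unfolding local_min_def
    using cubic_curvature_minimum[OF assms _ t(1) u2(1)] cubic_curvature_minimum[OF assms _ t(1) u2(2)] t(3)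
    by auto
  moreover have "saddle_point ?g (m + v)" "saddle_point ?g (m + - v)"
    using t v2 assms by (intro cubic_curvature_saddle; auto)+
  ultimately show thesis
    by (intro that[of u v]) (simp add: critical_configuration_def)
qed

theorem mainTheorem1:
  fixes a b c :: complex
  assumes "\<not> collinear {a, b, c}"
    and "\<not> equilateral a b c"
  shows "\<exists>p m1 m2 s1 s2.
    critical_configuration (graph_curvature (tri_cubic a b c)) p m1 m2 s1 s2 \<and>
    (\<forall>a' b' c'.
       \<not> collinear {a', b', c'} \<longrightarrow> \<not> equilateral a' b' c' \<longrightarrow>
       tri_b a' b' c' = tri_b a b c \<longrightarrow> tri_B a' b' c' = tri_B a b c \<longrightarrow>
       critical_configuration (graph_curvature (tri_cubic a' b' c')) p m1 m2 s1 s2)"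
proof -
  have "tri_B a b c \<noteq> 0" using assms(2) equilateral_if_tri_B_eq_0 by blast
  then obtain u v where "let m = tri_b a b c in critical_configuration
      (\<lambda>z. cubic_curvature (tri_B a b c) (z - m)) m (m + u) (m - u) (m + v) (m - v)"
    unfolding Let_def by (rule cubic_curvature_critical_configuration)
  then show ?thesis unfolding graph_curvature_tri_cubic Let_def by fastforce
qed

end
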